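(* Let $g,h:\mathbb{R}^m\to\mathbb{R}\cup\{+\infty\}$ and $\phi=g-h$ satisfy the standing assumptions described in the context. For any $x_0\in\mathbb{R}^m$, consider the sequence $\{x_k\}$ generated by the BDCA (described in the context). Suppose that $\{x_k\}$ has a cluster point $x^*$, that $\nabla g$ is locally Lipschitz continuous around $x^*$, and that $\phi$ satisfies the strong Kurdyka–Łojasiewicz inequality at $x^*$. Then $\{x_k\}$ converges to $x^*$, which is a critical point of $(\mathcal P)$.
   Context: Problem. $\|\cdot\|$ and $\langle\cdot,\cdot\rangle$ are the Euclidean norm and inner product of $\mathbb{R}^m$. We consider $(\mathcal P)$: minimize $\phi(x):=g(x)-h(x)$ over $x\in\mathbb{R}^m$, where $g,h:\mathbb{R}^m\to\mathbb{R}\cup\{+\infty\}$ are proper convex functions, with the conventions $(+\infty)-(+\infty)=+\infty$, $(+\infty)-\lambda=+\infty$ and $\lambda-(+\infty)=-\infty$ for $\lambda\in\,]-\infty,+\infty[$. We write $\operatorname{dom} f=\{x: f(x)<+\infty\}$. The convex subdifferential is $\partial h(\bar x)=\{u\in\mathbb{R}^m: h(x)-h(\bar x)\ge\langle u,x-\bar x\rangle\ \forall x\in\mathbb{R}^m\}$ for $\bar x\in\operatorname{dom}h$, and $\partial h(\bar x)=\emptyset$ otherwise. A point $\bar x$ is a critical point of $(\mathcal P)$ if $\nabla g(\bar x)\in\partial h(\bar x)$. Standing assumptions. (Assumption 1) Both $g$ and $h$ are strongly convex with modulus $\rho>0$, i.e. $g-\frac{\rho}{2}\|\cdot\|^2$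 and $h-\frac{\rho}{2}\|\cdot\|^2$ are convex. (Assumption 2) $\partial h(x)\ne\emptyset$ for all $x\in\operatorname{dom}h$; $g$ is continuously differentiable on an open set containing $\operatorname{dom}h$; and $\inf_{x\in\mathbb{R}^m}\phi(x)>-\infty$. BDCA (Boosted DC Algorithm). Step 1. Fix $\alpha>0$ and $0<\beta<1$. Let $x_0$ be any initial point and set $k:=0$. Step 2. Select $u_k\in\partial h(x_k)$ and solve the strongly convex problem $(\mathcal P_k)$: minimize $g(x)-\langle u_k,x\rangle$ over $x\in\mathbb{R}^m$, to obtain its unique solution $y_k$. Step 3. Set $d_k:=y_k-x_k$. If $d_k=0$, stop and return $x_k$. Otherwise go to Step 4. Step 4. Choose any $\overline\lambda_k\ge0$ and set $\lambda_k:=\overline\lambda_k$. While $\phi(y_k+\lambda_kd_k)>\phi(y_k)-\alpha\lambda_k^2\|d_k\|^2$, replace $\lambda_k:=\beta\lambda_k$. Step 5. Set $x_{k+1}:=y_k+\lambda_kd_k$, set $k:=k+1$, and go to Step 2. It is understood that Step 2 can be carried out at each iteration, i.e. $\partial h(x_k)\neq\emptyset$ and $(\mathcal P_k)$ has a (unique) solution $y_k$. Clarke subdifferential. For a locally Lipschitz function $f$, $\partial_Cf(\bar x)=\operatorname{co}\{\lim_{x\to\bar x,\ x\notin\Omega_f}\nabla f(x)\}$, the convex hull of all limits of gradients along sequences converging to $\bar x$ and avoiding the Lebesgue-null set $\Omega_f$ where $f$ fails to be differentiable. Strong Kurdyka–Łojasiewicz inequality. A locally Lipschitz function $f:\mathbb{R}^m\to\mathbb{R}$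 satisfies the strong Kurdyka–Łojasiewicz inequality at $x^*\in\mathbb{R}^m$ if there exist $\eta\in\,]0,+\infty[$, a neighborhood $U$ of $x^*$, and a concave function $\varphi:[0,\eta]\to[0,+\infty[$ such that: (i) $\varphi(0)=0$; (ii) $\varphi$ is of class $\mathcal C^1$ on $]0,\eta[$; (iii) $\varphi'>0$ on $]0,\eta[$; (iv) for all $x\in U$ with $f(x^* )<f(x)<f(x^* )+\eta$ we have $\varphi'(f(x)-f(x^* ))\operatorname{dist}(0,\partial_Cf(x))\ge1$. (Thus, assuming this inequality for $\phi$ includes that $\phi$ is real-valued and locally Lipschitz.) Here $\operatorname{dist}(0,S)=\inf_{s\in S}\|s\|$. *)

theory Defs
  imports "HOL-Analysis.Analysis" "HOL-Library.While_Combinator"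
begin

section \<open>Extended-real-valued convex functions\<close>

text \<open>Functions into the reals with \<open>+\<infinity>\<close> adjoined are \<open>ereal\<close>-valued functions that never take
  the value \<open>-\<infinity>\<close>; the latter is part of properness.\<close>

definition edom :: "('a \<Rightarrow> ereal) \<Rightarrow> 'a set" where
  "edom f = {x. f x < \<infinity>}"

definition proper :: "('a \<Rightarrow> ereal) \<Rightarrow> bool" where
  "proper f \<longleftrightarrow> (\<forall>x. f x \<noteq> -\<infinity>) \<and> edom f \<noteq> {}"

text \<open>Only meant for functions that avoid \<open>-\<infinity>\<close>, so that no sum below is of the form
  \<open>\<infinity> + (-\<infinity>)\<close>; taking \<open>t\<close> in the open interval avoids \<open>0 * \<infinity>\<close>.\<close>

definition econvex :: "('a::real_vector \<Rightarrow> ereal) \<Rightarrow> bool" where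
  "econvex f \<longleftrightarrow>
     (\<forall>x y. \<forall>t\<in>{0<..<1}. f ((1 - t) *\<^sub>R x + t *\<^sub>R y) \<le> ereal (1 - t) * f x + ereal t * f y)"

definition strongly_econvex :: "real \<Rightarrow> ('a::real_normed_vector \<Rightarrow> ereal) \<Rightarrow> bool" where
  "strongly_econvex \<rho> f \<longleftrightarrow> econvex (\<lambda>x. f x - ereal (\<rho> / 2 * (norm x)\<^sup>2))"

definition subdifferential :: "('a::real_inner \<Rightarrow> ereal) \<Rightarrow> 'a \<Rightarrow> 'a set" where
  "subdifferential h xb =
     (if xb \<in> edom h then {u. \<forall>x. h x - h xb \<ge> ereal (u \<bullet> (x - xb))} else {})"

text \<open>An extended-real-valued function is differentiable at a point only if it is finite around
  it: \<open>real_of_ereal\<close> sends infinite values to \<open>0\<close>, so finiteness has to be asked for.\<close>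

definition has_egradient :: "('a::real_inner \<Rightarrow> ereal) \<Rightarrow> 'a \<Rightarrow> 'a \<Rightarrow> bool" where
  "has_egradient f x v \<longleftrightarrow>
     (\<forall>\<^sub>F z in nhds x. \<bar>f z\<bar> \<noteq> \<infinity>) \<and> GDERIV (\<lambda>z. real_of_ereal (f z)) x :> v"

definition ediff_on :: "('a::real_inner \<Rightarrow> ereal) \<Rightarrow> 'a set \<Rightarrow> bool" where
  "ediff_on f S \<longleftrightarrow> (\<forall>x\<in>S. \<exists>v. has_egradient f x v)"

definition egradient :: "('a::real_inner \<Rightarrow> ereal) \<Rightarrow> 'a \<Rightarrow> 'a" where
  "egradient f x = (THE v. has_egradient f x v)"

definition cont_ediff_on :: "('a::real_inner \<Rightarrow> ereal) \<Rightarrow> 'a set \<Rightarrow> bool" where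
  "cont_ediff_on f S \<longleftrightarrow> ediff_on f S \<and> continuous_on S (egradient f)"

definition egradient_lipschitz_around :: "('a::real_inner \<Rightarrow> ereal) \<Rightarrow> 'a \<Rightarrow> bool" where
  "egradient_lipschitz_around f x \<longleftrightarrow>
     (\<exists>U L. open U \<and> x \<in> U \<and> ediff_on f U \<and> L-lipschitz_on U (egradient f))"


section \<open>The DC problem\<close>

definition dc_objective :: "('a \<Rightarrow> ereal) \<Rightarrow> ('a \<Rightarrow> ereal) \<Rightarrow> 'a \<Rightarrow> ereal" where
  "dc_objective g h x = g x - h x"

text \<open>Subtraction on \<open>ereal\<close> follows the conventions of DC programming.\<close>

lemma ereal_minus_conventions:
  "(\<infinity>::ereal) - \<infinity> = \<infinity>" "(\<infinity>::ereal) - ereal c = \<infinity>" "ereal c - \<infinity> = -\<infinity>"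
  by simp_all

definition dc_critical :: "('a::real_inner \<Rightarrow> ereal) \<Rightarrow> ('a \<Rightarrow> ereal) \<Rightarrow> 'a \<Rightarrow> bool" where
  "dc_critical g h x \<longleftrightarrow> (\<exists>v. has_egradient g x v \<and> v \<in> subdifferential h x)"


section \<open>The Boosted DC Algorithm\<close>

text \<open>The backtracking loop run from the trial step \<open>lbar\<close>; \<open>Some l\<close> means that it terminates
  with the step \<open>l\<close>.\<close>

definition bdca_line_search ::
    "('a::real_inner \<Rightarrow> ereal) \<Rightarrow> real \<Rightarrow> real \<Rightarrow> 'a \<Rightarrow> 'a \<Rightarrow> real \<Rightarrow> real option" where
  "bdca_line_search \<phi> \<alpha> \<beta> y d lbar =
     while_option (\<lambda>l. \<phi> (y + l *\<^sub>R d) > \<phi> y - ereal (\<alpha> * l\<^sup>2 * (norm d)\<^sup>2)) (\<lambda>l. \<beta> * l) lbar"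

text \<open>If the algorithm stops at iteration \<open>k\<close>, the generated sequence is continued by the
  returned point \<open>x k\<close>; freezing \<open>u\<close> and \<open>y\<close> as well keeps the run from being resumed with another
  subgradient. Runs that never stop are exactly those with \<open>y k \<noteq> x k\<close> for all \<open>k\<close>.\<close>

definition bdca_sequence ::
    "('a::real_inner \<Rightarrow> ereal) \<Rightarrow> ('a \<Rightarrow> ereal) \<Rightarrow> real \<Rightarrow> real \<Rightarrow> (nat \<Rightarrow> 'a) \<Rightarrow> bool" where
  "bdca_sequence g h \<alpha> \<beta> x \<longleftrightarrow>
     (\<exists>u y. \<forall>k.
        u k \<in> subdifferential h (x k) \<and>
        is_arg_min (\<lambda>z. g z - ereal (u k \<bullet> z)) (\<lambda>z. True) (y k) \<and>
        (let d = y k - x k in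
          if d = 0 then x (Suc k) = x k \<and> u (Suc k) = u k \<and> y (Suc k) = y k
          else \<exists>lbar\<ge>0. \<exists>l. bdca_line_search (dc_objective g h) \<alpha> \<beta> (y k) d lbar = Some l \<and>
                            x (Suc k) = y k + l *\<^sub>R d))"


section \<open>Clarke subdifferential and the strong Kurdyka--Lojasiewicz inequality\<close>

definition locally_lipschitz :: "('a::metric_space \<Rightarrow> real) \<Rightarrow> bool" where
  "locally_lipschitz f \<longleftrightarrow> (\<forall>x. \<exists>U L. open U \<and> x \<in> U \<and> L-lipschitz_on U f)"

text \<open>The sequence \<open>s\<close> avoids the points of non-differentiability of \<open>f\<close>, and \<open>w n\<close> is the
  gradient of \<open>f\<close> at \<open>s n\<close>.\<close>

definition clarke_subdifferential :: "('a::real_inner \<Rightarrow> real) \<Rightarrow> 'a \<Rightarrow> 'a set" where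
  "clarke_subdifferential f x =
     convex hull {v. \<exists>s w. (\<forall>n. GDERIV f (s n) :> w n) \<and> s \<longlonglongrightarrow> x \<and> w \<longlonglongrightarrow> v}"

text \<open>Here \<open>infdist\<close> is the distance to a nonempty set: by Rademacher's theorem the Clarke
  subdifferential of a locally Lipschitz function on a Euclidean space is nonempty.\<close>

definition strong_KL :: "('a::euclidean_space \<Rightarrow> real) \<Rightarrow> 'a \<Rightarrow> bool" where
  "strong_KL f xs \<longleftrightarrow> locally_lipschitz f \<and>
     (\<exists>\<eta>>0. \<exists>U \<psi> \<psi>'. open U \<and> xs \<in> U \<and>
        concave_on {0..\<eta>} \<psi> \<and> (\<forall>t\<in>{0..\<eta>}. \<psi> t \<ge> 0) \<and>
        \<psi> 0 = 0 \<and>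
        (\<forall>t\<in>{0<..<\<eta>}. (\<psi> has_real_derivative \<psi>' t) (at t)) \<and> continuous_on {0<..<\<eta>} \<psi>' \<and>
        (\<forall>t\<in>{0<..<\<eta>}. \<psi>' t > 0) \<and>
        (\<forall>x\<in>U. f xs < f x \<and> f x < f xs + \<eta> \<longrightarrow>
           \<psi>' (f x - f xs) * infdist 0 (clarke_subdifferential f x) \<ge> 1))"

end

theory Submission
  imports Defs
begin

text \<open>A DC step decreases \<open>\<phi>\<close> by \<open>\<rho> \<parallel>d\<^sub>k\<parallel>\<^sup>2\<close> and the line search by a further
  \<open>\<alpha> \<lambda>\<^sub>k\<^sup>2 \<parallel>d\<^sub>k\<parallel>\<^sup>2\<close>; together they dominate \<open>\<parallel>x\<^sub>k\<^sub>+\<^sub>1 - x\<^sub>k\<parallel> \<parallel>d\<^sub>k\<parallel>\<close>, as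
  \<open>x\<^sub>k\<^sub>+\<^sub>1 - x\<^sub>k = (1 + \<lambda>\<^sub>k) d\<^sub>k\<close>. Moreover \<open>\<nabla>g(x\<^sub>k) - u\<^sub>k = \<nabla>g(x\<^sub>k) - \<nabla>g(y\<^sub>k)\<close> has norm at most
  \<open>L \<parallel>d\<^sub>k\<parallel>\<close> and lies in the closure of the Clarke subdifferential of \<open>\<phi>\<close> at \<open>x\<^sub>k\<close>, so the
  Kurdyka-Lojasiewicz inequality makes the step lengths summable near the cluster point.

  The membership in the Clarke subdifferential needs no measure theory: if a hyperplane separated
  the two, one would approach \<open>x\<^sub>k\<close> along its normal through points of differentiability
  of \<open>h\<close> and contradict the monotonicity of \<open>\<partial>h\<close>. Such points are dense because a local maximizer
  of \<open>h - K \<parallel>\<cdot> - z\<parallel>\<^sup>2\<close> is one, \<open>h\<close> being squeezed there between an affine and a smooth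
  function.\<close>

section \<open>Subgradients, strong convexity and gradients\<close>

text \<open>Real-valued form of \<open>subdifferential\<close>, free of extended-real subtraction;
  it applies because \<open>g\<close> and \<open>h\<close> turn out to be finite everywhere.\<close>

definition is_subgradient :: "('a::real_inner \<Rightarrow> real) \<Rightarrow> 'a \<Rightarrow> 'a \<Rightarrow> bool" where
  "is_subgradient F a v \<longleftrightarrow> (\<forall>z. F a + v \<bullet> (z - a) \<le> F z)"

lemma is_subgradient_monotone:
  assumes "is_subgradient F a v" "is_subgradient F b w"
  shows "0 \<le> (w - v) \<bullet> (b - a)"
proof -
  have "F a + v \<bullet> (b - a) \<le> F b" "F b + w \<bullet> (a - b) \<le> F a"
    using assms by (auto simp: is_subgradient_def)
  then show ?thesis by (simp add: algebra_simps)
qed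

lemma norm_convex_combination_sq:
  fixes a b :: "'a::real_inner"
  shows "(norm ((1 - t) *\<^sub>R a + t *\<^sub>R b))\<^sup>2
    = (1 - t) * (norm a)\<^sup>2 + t * (norm b)\<^sup>2 - t * (1 - t) * (norm (b - a))\<^sup>2"
  unfolding power2_norm_eq_inner
  by (simp add: inner_simps inner_commute algebra_simps power2_eq_square)

text \<open>Convexity on the segment is played against the subgradient inequality at
  \<open>a + t (b - a)\<close>; dividing by \<open>t\<close> and letting it tend to 0 turns the
  factor \<open>1 - t\<close> into 1.\<close>

lemma strongly_convex_subgradient_ineq:
  fixes F :: "'a::real_inner \<Rightarrow> real"
  assumes conv: "convex_on UNIV (\<lambda>z. F z - \<rho> / 2 * (norm z)\<^sup>2)"
    and sub: "is_subgradient F a v"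
  shows "F a + v \<bullet> (b - a) + \<rho> / 2 * (norm (b - a))\<^sup>2 \<le> F b"
proof -
  define n where "n = (norm (b - a))\<^sup>2"
  have le: "v \<bullet> (b - a) + \<rho> / 2 * (1 - t) * n \<le> F b - F a" if t: "0 < t" "t < 1" for t
  proof -
    define p where "p = (1 - t) *\<^sub>R a + t *\<^sub>R b"
    have "F p - \<rho> / 2 * (norm p)\<^sup>2
        \<le> (1 - t) * (F a - \<rho> / 2 * (norm a)\<^sup>2) + t * (F b - \<rho> / 2 * (norm b)\<^sup>2)"
      using convex_onD[OF conv, of t a b] t by (simp add: p_def)
    moreover have "(norm p)\<^sup>2 = (1 - t) * (norm a)\<^sup>2 + t * (norm b)\<^sup>2 - t * (1 - t) * n"
      unfolding p_def n_def by (rule norm_convex_combination_sq)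
    ultimately have "F p \<le> \<rho> / 2 * ((1 - t) * (norm a)\<^sup>2 + t * (norm b)\<^sup>2 - t * (1 - t) * n)
        + (1 - t) * (F a - \<rho> / 2 * (norm a)\<^sup>2) + t * (F b - \<rho> / 2 * (norm b)\<^sup>2)"
      by simp
    also have "\<dots> = (1 - t) * F a + t * F b - \<rho> / 2 * (t * (1 - t) * n)"
      by (simp add: field_simps)
    finally have "F p \<le> (1 - t) * F a + t * F b - \<rho> / 2 * (t * (1 - t) * n)" .
    moreover have "p - a = t *\<^sub>R (b - a)"
      by (simp add: p_def algebra_simps)
    then have "F a + t * (v \<bullet> (b - a)) \<le> F p"
      using sub unfolding is_subgradient_def by (metis inner_scaleR_right)
    ultimately have "t * (v \<bullet> (b - a)) + \<rho> / 2 * (t * (1 - t) * n) \<le> t * F b - t * F a"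
      by (simp add: left_diff_distrib)
    moreover have "t * (\<rho> / 2 * (1 - t) * n) = \<rho> / 2 * (t * (1 - t) * n)" by simp
    ultimately have "t * (v \<bullet> (b - a) + \<rho> / 2 * (1 - t) * n) \<le> t * (F b - F a)"
      unfolding distrib_left[of t] right_diff_distrib[of t "F b"] by linarith
    then show ?thesis using t by simp
  qed
  have "((\<lambda>t. v \<bullet> (b - a) + \<rho> / 2 * (1 - t) * n) \<longlongrightarrow> v \<bullet> (b - a) + \<rho> / 2 * (1 - 0) * n)
      (at_right (0::real))"
    by (intro tendsto_intros)
  moreover have "\<forall>\<^sub>F t in at_right (0::real). v \<bullet> (b - a) + \<rho> / 2 * (1 - t) * n \<le> F b - F a"
    unfolding eventually_at_right[OF zero_less_one] using le by (intro exI[of _ 1]) auto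
  ultimately have "v \<bullet> (b - a) + \<rho> / 2 * (1 - 0) * n \<le> F b - F a"
    by (rule tendsto_upperbound) simp
  then show ?thesis by (simp add: n_def)
qed

text \<open>\<open>F\<close> minus the linear function of \<open>u\<close> is minimal at
  \<open>a\<close>, so its derivative vanishes there. This will identify \<open>u k\<close> with the
  gradient of \<open>g\<close> at \<open>y k\<close>.\<close>

lemma GDERIV_subgradient_unique:
  assumes "GDERIV F a :> v" "is_subgradient F a u"
  shows "u = v"
proof -
  have "((\<lambda>z. F z - u \<bullet> z) has_derivative (\<lambda>z. z \<bullet> v - u \<bullet> z)) (at a)"
    using assms(1) unfolding gderiv_def by (auto intro!: derivative_eq_intros)
  moreover have "F a - u \<bullet> a \<le> F z - u \<bullet> z" for z
    using assms(2) by (simp add: is_subgradient_def inner_diff_right algebra_simps)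
  ultimately have "(\<lambda>z. z \<bullet> v - u \<bullet> z) = (\<lambda>z. 0)"
    by (intro has_derivative_local_min) auto
  then have "(v - u) \<bullet> v - u \<bullet> (v - u) = 0" by meson
  then have "(v - u) \<bullet> (v - u) = 0" by (simp add: algebra_simps inner_commute)
  then show ?thesis by simp
qed

lemma GDERIV_unique:
  assumes "GDERIV F a :> v" "GDERIV F a :> w"
  shows "v = w"
proof -
  have "(\<lambda>z. z \<bullet> v) = (\<lambda>z. z \<bullet> w)"
    using assms unfolding gderiv_def by (rule has_derivative_unique)
  then show ?thesis by (metis inner_commute vector_eq_ldot)
qed


section \<open>Points of differentiability and bounds on subgradients\<close>

text \<open>Without the affine minorant of slope \<open>v\<close>, the upper function
  \<open>Q\<close> has a local minimum 0 at \<open>a\<close>, hence zero derivative; the remainder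
  \<open>E\<close> lies between 0 and \<open>Q\<close>, so it is of smaller order than the distance
  to \<open>a\<close>.\<close>

lemma GDERIV_squeeze:
  fixes F q :: "'a::real_inner \<Rightarrow> real"
  assumes sub: "is_subgradient F a v"
    and q: "GDERIV q a :> p" "q a = F a" "\<forall>\<^sub>F w in at a. F w \<le> q w"
  shows "GDERIV F a :> v"
proof -
  define Q where "Q w = q w - F a - v \<bullet> (w - a)" for w
  define E where "E w = F w - F a - v \<bullet> (w - a)" for w
  have E0: "0 \<le> E w" for w using sub by (simp add: E_def is_subgradient_def algebra_simps)
  have EQ: "\<forall>\<^sub>F w in at a. E w \<le> Q w"
    using q(3) by eventually_elim (simp add: E_def Q_def)
  have [simp]: "Q a = 0" "E a = 0" by (simp_all add: Q_def E_def q(2))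
  have Qd: "(Q has_derivative (\<lambda>z. z \<bullet> p - v \<bullet> z)) (at a)"
    using q(1) unfolding gderiv_def Q_def by (auto intro!: derivative_eq_intros)
  moreover have "\<forall>\<^sub>F w in at a. Q a \<le> Q w"
    using EQ by eventually_elim (use E0 in \<open>force intro: order_trans\<close>)
  ultimately have "(\<lambda>z. z \<bullet> p - v \<bullet> z) = (\<lambda>z. 0)"
    by (rule has_derivative_local_min)
  with Qd have "((\<lambda>w. norm (Q w) / norm (w - a)) \<longlongrightarrow> 0) (at a)"
    by (simp add: has_derivative_iff_norm)
  then have "((\<lambda>w. norm (E w) / norm (w - a)) \<longlongrightarrow> 0) (at a)"
    by (rule Lim_null_comparison[rotated])
      (use EQ in eventually_elim, use E0 in \<open>auto intro!: divide_right_mono\<close>)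
  then have "(E has_derivative (\<lambda>z. 0)) (at a)"
    by (simp add: has_derivative_iff_norm)
  then have "((\<lambda>w. E w + F a + v \<bullet> (w - a)) has_derivative (\<lambda>z. z \<bullet> v)) (at a)"
    by (auto intro!: derivative_eq_intros simp: inner_commute)
  then show ?thesis by (simp add: gderiv_def E_def)
qed

lemma dense_differentiability:
  fixes F :: "'a::euclidean_space \<Rightarrow> real"
  assumes cont: "continuous_on UNIV F" and sub: "\<And>a. \<exists>v. is_subgradient F a v" and "0 < r"
  shows "\<exists>a v. dist a z < r \<and> is_subgradient F a v \<and> GDERIV F a :> v"
proof -
  have "\<exists>b\<in>cball z r. \<forall>w\<in>cball z r. F w \<le> F b"
    using \<open>0 < r\<close> by (intro continuous_attains_sup continuous_on_subset[OF cont]) auto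
  then obtain b where b: "\<And>w. w \<in> cball z r \<Longrightarrow> F w \<le> F b" by blast
  \<comment> \<open>The penalty equals \<open>F b - F z + 1\<close> on the sphere. As
    \<open>F\<close> is at most \<open>F b\<close>, \<open>P\<close> lies below \<open>P z\<close>
    there, which keeps its maximizer inside the ball.\<close>
  define K where "K = (F b - F z + 1) / r\<^sup>2"
  define P where "P w = F w - K * ((w - z) \<bullet> (w - z))" for w
  have "\<exists>a\<in>cball z r. \<forall>w\<in>cball z r. P w \<le> P a"
    using \<open>0 < r\<close> unfolding P_def
    by (intro continuous_attains_sup continuous_intros continuous_on_subset[OF cont]) auto
  then obtain a where a: "a \<in> cball z r" "\<And>w. w \<in> cball z r \<Longrightarrow> P w \<le> P a" by blast
  have "dist z a \<noteq> r"
  proof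
    assume "dist z a = r"
    then have "(a - z) \<bullet> (a - z) = r\<^sup>2"
      by (simp add: dist_norm norm_minus_commute flip: power2_norm_eq_inner)
    then have "P a = F a - (F b - F z + 1)" using \<open>0 < r\<close> by (simp add: P_def K_def)
    moreover have "F z \<le> P a" using a(2)[of z] \<open>0 < r\<close> by (simp add: P_def)
    ultimately show False using b[OF a(1)] by simp
  qed
  then have az: "dist z a < r" using a(1) by simp
  obtain v where v: "is_subgradient F a v" using sub by blast
  define q where "q w = P a + K * ((w - z) \<bullet> (w - z))" for w
  have "GDERIV q a :> (2 * K) *\<^sub>R (a - z)"
    unfolding q_def gderiv_def
    by (auto intro!: derivative_eq_intros simp: algebra_simps inner_commute)
  moreover have "q a = F a" by (simp add: q_def P_def)
  moreover have "\<forall>\<^sub>F w in at a. F w \<le> q w"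
  proof -
    have "\<forall>\<^sub>F w in at a. w \<in> ball z r"
      using az by (intro eventually_at_in_open') auto
    then show ?thesis
    proof eventually_elim
      case (elim w)
      then have "P w \<le> P a" by (intro a(2)) simp
      then show ?case by (simp add: q_def P_def)
    qed
  qed
  ultimately have "GDERIV F a :> v" using GDERIV_squeeze v by blast
  with v az show ?thesis by (auto simp: dist_commute)
qed

text \<open>The unit step \<open>sgn v\<close> raises \<open>F\<close> by at least
  \<open>norm v\<close>, while both of its endpoints lie in the ball of radius 2, where
  \<open>F\<close> is bounded.\<close>

lemma subgradients_bounded:
  fixes F :: "'a::euclidean_space \<Rightarrow> real"
  assumes cont: "continuous_on UNIV F"
  shows "bounded {v. \<exists>a\<in>cball z 1. is_subgradient F a v}"
proof -
  have "bounded (F ` cball z 2)"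
    by (intro compact_imp_bounded compact_continuous_image continuous_on_subset[OF cont]) auto
  then obtain M where M: "\<And>w. w \<in> cball z 2 \<Longrightarrow> \<bar>F w\<bar> \<le> M"
    unfolding bounded_iff by fastforce
  have "norm v \<le> 2 * M" if "a \<in> cball z 1" "is_subgradient F a v" for a v
  proof -
    have "F a + v \<bullet> sgn v \<le> F (a + sgn v)"
      using that(2) unfolding is_subgradient_def by (metis add_diff_cancel_left')
    moreover have "v \<bullet> sgn v = norm v"
      by (cases "v = 0") (auto simp: sgn_div_norm field_simps simp flip: power2_norm_eq_inner,
          simp add: power2_eq_square)
    moreover have "dist z (a + sgn v) \<le> dist z a + dist a (a + sgn v)" by (rule dist_triangle)
    then have "a + sgn v \<in> cball z 2" "a \<in> cball z 2"
      using that(1) by (auto simp: dist_norm norm_sgn split: if_splits)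
    ultimately show ?thesis using M[of a] M[of "a + sgn v"] by linarith
  qed
  then show ?thesis unfolding bounded_iff by blast
qed


section \<open>The Clarke subdifferential of a difference\<close>

lemma infdist_le_closure:
  assumes "a \<in> closure A"
  shows "infdist x A \<le> dist x a"
proof (cases "A = {}")
  case False
  then have "infdist a A = 0" using assms in_closure_iff_infdist_zero by blast
  then show ?thesis using infdist_triangle[of x A a] by simp
qed (use assms in simp)

text \<open>It is enough that \<open>G' a - u\<close> lies in the closure of the convex hull of the
  limiting gradients, because passing to the closure does not change distances.\<close>

lemma infdist_clarke_subdifferential_le:
  fixes G H :: "'a::euclidean_space \<Rightarrow> real"
  assumes G: "\<And>z. GDERIV G z :> G' z" and contG': "isCont G' a"
    and contH: "continuous_on UNIV H" and sub: "\<And>z. \<exists>v. is_subgradient H z v"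
    and u: "is_subgradient H a u"
  shows "infdist 0 (clarke_subdifferential (\<lambda>z. G z - H z) a) \<le> norm (G' a - u)"
proof -
  define A where "A = {v. \<exists>s w. (\<forall>n. GDERIV (\<lambda>z. G z - H z) (s n) :> w n) \<and> s \<longlonglongrightarrow> a \<and> w \<longlonglongrightarrow> v}"
  have "G' a - u \<in> closure (convex hull A)"
  proof (rule ccontr)
    assume "G' a - u \<notin> closure (convex hull A)"
    then obtain e b where e: "e \<bullet> (G' a - u) < b" "\<And>c. c \<in> closure (convex hull A) \<Longrightarrow> b < e \<bullet> c"
      using separating_hyperplane_closed_point[of "closure (convex hull A)" "G' a - u"]
      by (auto simp: convex_closure)
    define t where "t n = inverse (real (Suc n))" for n
    have t0: "0 < t n" "t n \<le> 1" for n by (simp_all add: t_def field_simps)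
    have tlim: "t \<longlonglongrightarrow> 0" unfolding t_def by (rule LIMSEQ_inverse_real_of_nat)
    \<comment> \<open>The error \<open>(t n)^2\<close> is of smaller order than the step
      \<open>t n\<close>, so the rescaled displacements \<open>q n\<close> below still converge to
      \<open>e\<close>.\<close>
    have "\<exists>s v. dist s (a + t n *\<^sub>R e) < (t n)\<^sup>2 \<and> is_subgradient H s v \<and> GDERIV H s :> v" for n
      using t0(1)[of n] by (intro dense_differentiability contH sub) simp
    then obtain s v where s: "\<And>n. dist (s n) (a + t n *\<^sub>R e) < (t n)\<^sup>2"
      and v: "\<And>n. is_subgradient H (s n) (v n)" "\<And>n. GDERIV H (s n) :> v n"
      by metis
    define q where "q n = (s n - a) /\<^sub>R t n" for n
    have qe: "norm (q n - e) \<le> t n" for n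
    proof -
      have "t n *\<^sub>R (q n - e) = s n - (a + t n *\<^sub>R e)"
        using t0(1)[of n] by (simp add: q_def algebra_simps)
      then have "t n * norm (q n - e) = dist (s n) (a + t n *\<^sub>R e)"
        using t0(1)[of n] by (metis abs_of_pos dist_norm norm_scaleR)
      then have "t n * norm (q n - e) \<le> t n * t n"
        using s[of n] by (simp add: power2_eq_square)
      then show ?thesis using t0(1)[of n] by simp
    qed
    have "(\<lambda>n. q n - e) \<longlonglongrightarrow> 0"
      using tlim by (rule Lim_null_comparison[rotated]) (simp add: qe)
    then have qlim: "q \<longlonglongrightarrow> e" by (rule LIM_zero_cancel)
    have "(\<lambda>n. a + t n *\<^sub>R q n) \<longlonglongrightarrow> a + 0 *\<^sub>R e"
      by (intro tendsto_intros tlim qlim)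
    moreover have "a + t n *\<^sub>R q n = s n" for n
      using t0(1)[of n] by (simp add: q_def)
    ultimately have slim: "s \<longlonglongrightarrow> a" by simp
    have "\<forall>\<^sub>F n in sequentially. dist (s n) a < 1"
      using slim by (rule tendstoD) simp
    then obtain N where N: "\<And>n. N \<le> n \<Longrightarrow> dist (s n) a < 1"
      unfolding eventually_sequentially by blast
    have "v (n + N) \<in> {v. \<exists>z\<in>cball a 1. is_subgradient H z v}" for n
      using N[of "n + N"] v(1)[of "n + N"] by (auto simp: dist_commute intro!: bexI[of _ "s (n + N)"])
    then have "bounded (range (\<lambda>n. v (n + N)))"
      by (intro bounded_subset[OF subgradients_bounded[OF contH, of a]]) blast
    then obtain l r where r: "strict_mono (r :: nat \<Rightarrow> nat)" and l: "((\<lambda>n. v (n + N)) \<circ> r) \<longlonglongrightarrow> l"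
      using bounded_imp_convergent_subsequence by blast
    define i where "i n = r n + N" for n
    have i: "strict_mono i" using r by (auto simp: i_def strict_mono_def)
    have vlim: "(\<lambda>n. v (i n)) \<longlonglongrightarrow> l" using l by (simp add: i_def o_def)
    have silim: "(\<lambda>n. s (i n)) \<longlonglongrightarrow> a" and qilim: "(\<lambda>n. q (i n)) \<longlonglongrightarrow> e"
      using LIMSEQ_subseq_LIMSEQ[OF slim i] LIMSEQ_subseq_LIMSEQ[OF qlim i] by (simp_all add: o_def)
    have "(\<lambda>n. G' (s (i n)) - v (i n)) \<longlonglongrightarrow> G' a - l"
      by (intro tendsto_intros vlim isCont_tendsto_compose[OF contG'] silim)
    then have "G' a - l \<in> A"
      unfolding A_def using silim GDERIV_diff[OF G v(2)]
      by (intro CollectI exI[of _ "\<lambda>n. s (i n)"] exI[of _ "\<lambda>n. G' (s (i n)) - v (i n)"]) simp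
    then have "b < e \<bullet> (G' a - l)"
      by (intro e(2) subsetD[OF closure_subset] hull_inc)
    \<comment> \<open>Monotonicity between \<open>a\<close> and \<open>s n\<close>, divided by
      \<open>t n\<close>, survives the limit. It gives
      \<open>e \<bullet> (G' a - l) \<le> e \<bullet> (G' a - u)\<close>, against the
      separation.\<close>
    moreover have "0 \<le> (l - u) \<bullet> e"
    proof (rule tendsto_lowerbound)
      show "(\<lambda>n. (v (i n) - u) \<bullet> q (i n)) \<longlonglongrightarrow> (l - u) \<bullet> e"
        by (intro tendsto_intros vlim qilim)
      have "0 \<le> (v n - u) \<bullet> q n" for n
        using is_subgradient_monotone[OF u v(1), of n] t0(1)[of n] by (simp add: q_def)
      then show "\<forall>\<^sub>F n in sequentially. 0 \<le> (v (i n) - u) \<bullet> q (i n)" by simp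
    qed simp
    ultimately show False using e(1) by (simp add: algebra_simps inner_commute)
  qed
  then show ?thesis
    using infdist_le_closure[of "G' a - u" "convex hull A" 0]
    by (simp add: clarke_subdifferential_def A_def)
qed

section \<open>Convergence from a cluster point under the Kurdyka-Lojasiewicz inequality\<close>

text \<open>While the iterates stay in the ball, the steps telescope against \<open>P\<close>; starting close enough
  to the cluster point, they never leave it.\<close>

lemma convergent_to_cluster_point:
  fixes x :: "nat \<Rightarrow> 'a::real_normed_vector"
  assumes r: "strict_mono r" "(x \<circ> r) \<longlonglongrightarrow> l" and "0 < \<delta>"
    and P: "decseq P" "\<And>n. B \<le> P n"
    and step: "\<And>n. N \<le> n \<Longrightarrow> x n \<in> ball l \<delta> \<Longrightarrow> norm (x (Suc n) - x n) \<le> P n - P (Suc n)"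
  shows "x \<longlonglongrightarrow> l"
proof (rule metric_LIMSEQ_I)
  fix \<epsilon> :: real assume "0 < \<epsilon>"
  define \<gamma> where "\<gamma> = min \<epsilon> \<delta>"
  have "0 < \<gamma>" using \<open>0 < \<epsilon>\<close> \<open>0 < \<delta>\<close> by (simp add: \<gamma>_def)
  obtain p where p: "P \<longlonglongrightarrow> p" "\<And>n. p \<le> P n"
    using decseq_convergent[OF P(1), of B] P(2) by blast
  have "\<forall>\<^sub>F n in sequentially. P (r n) < p + \<gamma> / 2"
    using LIMSEQ_subseq_LIMSEQ[OF p(1) r(1)] \<open>0 < \<gamma>\<close>
    by (intro order_tendstoD(2)) (auto simp: o_def)
  moreover have "\<forall>\<^sub>F n in sequentially. dist ((x \<circ> r) n) l < \<gamma> / 2"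
    using \<open>0 < \<gamma>\<close> by (intro tendstoD[OF r(2)]) simp
  moreover have "\<forall>\<^sub>F n in sequentially. N \<le> r n"
    using filterlim_subseq[OF r(1)] by (simp add: filterlim_at_top)
  ultimately have "\<forall>\<^sub>F n in sequentially. P (r n) < p + \<gamma> / 2 \<and> dist (x (r n)) l < \<gamma> / 2 \<and> N \<le> r n"
    by eventually_elim simp
  \<comment> \<open>\<open>M\<close> is an index of the subsequence at which both the distance to
    \<open>l\<close> and the length \<open>P M - p\<close> still available are below
    \<open>\<gamma> / 2\<close>.\<close>
  then obtain M where M: "P M < p + \<gamma> / 2" "dist (x M) l < \<gamma> / 2" "N \<le> M"
    unfolding eventually_sequentially by blast
  have small: "dist (x n) l < \<gamma>" if "dist (x n) (x M) \<le> P M - P n" for n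
    using dist_triangle[of "x n" l "x M"] that M(1,2) p(2)[of n] by linarith
  have "dist (x n) (x M) \<le> P M - P n" if "M \<le> n" for n
    using that
  proof (induction n rule: dec_induct)
    case (step n)
    have "x n \<in> ball l \<delta>"
      using small[OF step.IH] by (simp add: dist_commute \<gamma>_def)
    then have "dist (x (Suc n)) (x n) \<le> P n - P (Suc n)"
      using assms(6)[of n] step.hyps M(3) by (simp add: dist_norm)
    then show ?case
      using dist_triangle[of "x (Suc n)" "x M" "x n"] step.IH by linarith
  qed simp
  then show "\<exists>M. \<forall>n\<ge>M. dist (x n) l < \<epsilon>"
    using small by (intro exI[of _ M]) (force simp: \<gamma>_def)
qed


lemma locally_lipschitz_isCont:
  assumes "locally_lipschitz f"
  shows "isCont f a"
proof -
  obtain U L where "open U" "a \<in> U" "L-lipschitz_on U f"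
    using assms unfolding locally_lipschitz_def by blast
  then show ?thesis
    using lipschitz_on_continuous_on continuous_on_eq_continuous_at by blast
qed

text \<open>The convex function \<open>- \<psi>\<close> lies above its tangents. Tangency is at an
  interior point, but \<open>t\<close> may be 0: the objective can reach its limit value in one
  step.\<close>

lemma concave_on_below_tangent:
  fixes \<psi> :: "real \<Rightarrow> real"
  assumes conc: "concave_on {0..\<eta>} \<psi>" and s: "0 < s" "s < \<eta>" and t: "0 \<le> t" "t \<le> \<eta>"
    and deriv: "(\<psi> has_real_derivative D) (at s)"
  shows "\<psi> t \<le> \<psi> s + D * (t - s)"
proof -
  have "(- D) * (t - s) \<le> - \<psi> t - (- \<psi> s)"
  proof (rule convex_on_imp_above_tangent)
    show "convex_on {0..\<eta>} (\<lambda>t. - \<psi> t)" using conc by (simp add: concave_on_def)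
    show "((\<lambda>t. - \<psi> t) has_real_derivative - D) (at s within {0..\<eta>})"
      using DERIV_minus[OF deriv] by (rule has_field_derivative_at_within)
  qed (use s t in auto)
  then show ?thesis by simp
qed

text \<open>Near \<open>l\<close> the potential \<open>L / c * \<psi> (f (x n) - f l)\<close> drops
  by at least the length of each step. The descent carries the factor \<open>1 + lam n\<close>
  because it is the ratio of the step length to \<open>norm (d n)\<close>.\<close>

lemma strong_KL_descent_convergence:
  fixes f :: "'a::euclidean_space \<Rightarrow> real"
  assumes KL: "strong_KL f l"
    and r: "strict_mono r" "(x \<circ> r) \<longlonglongrightarrow> l"
    and lam: "\<And>n. 0 \<le> lam n" "\<And>n. x (Suc n) - x n = (1 + lam n) *\<^sub>R d n"
    and "0 < c" and descent: "\<And>n. f (x (Suc n)) + c * (1 + lam n) * (norm (d n))\<^sup>2 \<le> f (x n)"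
    and "0 < \<delta>" "0 \<le> L"
    and error: "\<And>n. x n \<in> ball l \<delta> \<Longrightarrow> norm (d n) < \<delta> \<Longrightarrow>
      infdist 0 (clarke_subdifferential f (x n)) \<le> L * norm (d n)"
  shows "x \<longlonglongrightarrow> l \<and> d \<longlonglongrightarrow> 0"
proof -
  obtain \<eta> U \<psi> \<psi>' where "0 < \<eta>" and U: "open U" "l \<in> U"
    and conc: "concave_on {0..\<eta>} \<psi>" and "\<forall>t\<in>{0..\<eta>}. 0 \<le> \<psi> t"
    and "\<forall>t\<in>{0<..<\<eta>}. (\<psi> has_real_derivative \<psi>' t) (at t)"
    and "\<forall>t\<in>{0<..<\<eta>}. 0 < \<psi>' t"
    and kl: "\<forall>z\<in>U. f l < f z \<and> f z < f l + \<eta> \<longrightarrow>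
      1 \<le> \<psi>' (f z - f l) * infdist 0 (clarke_subdifferential f z)"
    using KL unfolding strong_KL_def by (elim conjE exE) (rule that; assumption)
  then have \<psi>0: "\<And>t. t \<in> {0..\<eta>} \<Longrightarrow> 0 \<le> \<psi> t"
    and deriv: "\<And>t. t \<in> {0<..<\<eta>} \<Longrightarrow> (\<psi> has_real_derivative \<psi>' t) (at t)"
    and pos: "\<And>t. t \<in> {0<..<\<eta>} \<Longrightarrow> 0 < \<psi>' t"
    by blast+
  have cd: "0 \<le> c * (1 + lam n) * (norm (d n))\<^sup>2" for n
    using \<open>0 < c\<close> lam(1)[of n] by simp
  have dec: "decseq (\<lambda>n. f (x n))"
    by (rule decseq_SucI) (use descent cd in \<open>smt (verit)\<close>)
  have cont: "isCont f l"
    using KL locally_lipschitz_isCont by (auto simp: strong_KL_def)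
  have frlim: "(\<lambda>n. f (x (r n))) \<longlonglongrightarrow> f l"
    using isCont_tendsto_compose[OF cont r(2)] by (simp add: o_def)
  have ge: "f l \<le> f (x n)" for n
  proof (rule LIMSEQ_le_const2[OF frlim], intro exI[of _ n] allI impI)
    fix m assume "n \<le> m"
    then have "n \<le> r m" using seq_suble[OF r(1), of m] by simp
    then show "f (x (r m)) \<le> f (x n)" using dec by (simp add: decseq_def)
  qed
  obtain F where F: "(\<lambda>n. f (x n)) \<longlonglongrightarrow> F"
    using decseq_convergent[OF dec, of "f l"] ge by blast
  have "F = f l"
    using LIMSEQ_unique[OF LIMSEQ_subseq_LIMSEQ[OF F r(1)]] frlim by (simp add: o_def)
  with F have flim: "(\<lambda>n. f (x n)) \<longlonglongrightarrow> f l" by simp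
  have "(\<lambda>n. (f (x n) - f (x (Suc n))) / c) \<longlonglongrightarrow> (f l - f l) / c"
    using \<open>0 < c\<close> by (intro tendsto_intros flim LIMSEQ_Suc) auto
  then have "(\<lambda>n. (f (x n) - f (x (Suc n))) / c) \<longlonglongrightarrow> 0" by simp
  then have "(\<lambda>n. (norm (d n))\<^sup>2) \<longlonglongrightarrow> 0"
  proof (rule Lim_null_comparison[rotated], intro always_eventually allI)
    fix n
    have "c * (norm (d n))\<^sup>2 * 1 \<le> c * (norm (d n))\<^sup>2 * (1 + lam n)"
      using \<open>0 < c\<close> lam(1)[of n] by (intro mult_left_mono) auto
    then have "c * (norm (d n))\<^sup>2 \<le> f (x n) - f (x (Suc n))"
      using descent[of n] by (simp add: algebra_simps)
    then show "norm ((norm (d n))\<^sup>2) \<le> (f (x n) - f (x (Suc n))) / c"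
      using \<open>0 < c\<close> by (simp add: field_simps)
  qed
  then have "(\<lambda>n. sqrt ((norm (d n))\<^sup>2)) \<longlonglongrightarrow> sqrt 0" by (rule tendsto_real_sqrt)
  then have dlim: "d \<longlonglongrightarrow> 0" by (simp add: tendsto_norm_zero_iff)
  obtain \<epsilon> where \<epsilon>: "0 < \<epsilon>" "ball l \<epsilon> \<subseteq> U" using U open_contains_ball by blast
  have "\<forall>\<^sub>F n in sequentially. norm (d n) < \<delta>"
    using tendstoD[OF dlim \<open>0 < \<delta>\<close>] by simp
  moreover have "\<forall>\<^sub>F n in sequentially. f (x n) < f l + \<eta>"
    using \<open>0 < \<eta>\<close> by (intro order_tendstoD(2)[OF flim]) simp
  ultimately have "\<forall>\<^sub>F n in sequentially. norm (d n) < \<delta> \<and> f (x n) < f l + \<eta>"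
    by eventually_elim simp
  then obtain N where N: "\<And>n. N \<le> n \<Longrightarrow> norm (d n) < \<delta>" "\<And>n. N \<le> n \<Longrightarrow> f (x n) < f l + \<eta>"
    unfolding eventually_sequentially by blast
  define s where "s n = f (x n) - f l" for n
  have s: "0 \<le> s n" "s (Suc n) \<le> s n" for n
    using ge[of n] decseq_SucD[OF dec, of n] by (simp_all add: s_def)
  have s\<eta>: "s n < \<eta>" if "N \<le> n" for n using N(2)[OF that] by (simp add: s_def)
  have tangent: "\<psi>' (s n) * (s n - s (Suc n)) \<le> \<psi> (s n) - \<psi> (s (Suc n))" if "N \<le> n" "0 < s n" for n
    using concave_on_below_tangent[OF conc \<open>0 < s n\<close> s\<eta>[OF \<open>N \<le> n\<close>], of "s (Suc n)" "\<psi>' (s n)"]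
      s[of n] s(1)[of "Suc n"] s\<eta>[OF that(1)] that(2) deriv[of "s n"]
    by (simp add: right_diff_distrib)
  \<comment> \<open>The split is due to \<open>\<psi>'\<close> being controlled only at positive
    arguments; from level 0 the values can no longer change.\<close>
  have mono: "\<psi> (s (Suc n)) \<le> \<psi> (s n)" if "N \<le> n" for n
  proof (cases "s n = 0")
    case True
    then have "s (Suc n) = s n" using s(2)[of n] s(1)[of "Suc n"] by simp
    then show ?thesis by simp
  next
    case False
    then have "0 < s n" using s(1)[of n] by simp
    moreover from this have "0 \<le> \<psi>' (s n) * (s n - s (Suc n))"
      using pos[of "s n"] s\<eta>[OF that] s(2)[of n] by simp
    ultimately show ?thesis using tangent[OF that] by linarith
  qed
  \<comment> \<open>\<open>max n N\<close> freezes the potential before \<open>N\<close>, where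
    \<open>s n\<close> may leave the domain of \<open>\<psi>\<close>, so that it is decreasing and
    nonnegative from the start.\<close>
  define P where "P n = L / c * \<psi> (s (max n N))" for n
  have Lc: "0 \<le> L / c" using \<open>0 \<le> L\<close> \<open>0 < c\<close> by simp
  have "x \<longlonglongrightarrow> l"
  proof (rule convergent_to_cluster_point[OF r])
    show "0 < min \<delta> \<epsilon>" using \<open>0 < \<delta>\<close> \<epsilon>(1) by simp
    show "decseq P"
    proof (rule decseq_SucI)
      fix n show "P (Suc n) \<le> P n"
      proof (cases "N \<le> n")
        case True
        then show ?thesis
          using mult_left_mono[OF mono[OF True] Lc] by (simp add: P_def max_def)
      next
        case False
        then have "max n N = max (Suc n) N" by simp
        then show ?thesis by (simp add: P_def)
      qed
    qed
    show "0 \<le> P n" for n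
      unfolding P_def using s(1)[of "max n N"] s\<eta>[of "max n N"]
      by (intro mult_nonneg_nonneg Lc \<psi>0) simp
    fix n assume n: "N \<le> n" "x n \<in> ball l (min \<delta> \<epsilon>)"
    have normx: "norm (x (Suc n) - x n) = (1 + lam n) * norm (d n)"
      using lam(1)[of n] by (simp add: lam(2))
    have Pn: "P n - P (Suc n) = L / c * (\<psi> (s n) - \<psi> (s (Suc n)))"
      using n(1) by (simp add: P_def max_def right_diff_distrib)
    have desc: "c * (1 + lam n) * (norm (d n))\<^sup>2 \<le> s n - s (Suc n)"
      using descent[of n] by (simp add: s_def)
    show "norm (x (Suc n) - x n) \<le> P n - P (Suc n)"
    proof (cases "s n = 0")
      \<comment> \<open>The Kurdyka-Lojasiewicz inequality says nothing at the level
        \<open>f l\<close>, but there the descent forces \<open>d n = 0\<close>.\<close>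
      case True
      then have "c * (1 + lam n) * (norm (d n))\<^sup>2 \<le> 0"
        using desc s(1)[of "Suc n"] by linarith
      then have "d n = 0"
        using \<open>0 < c\<close> lam(1)[of n] cd[of n] by (auto simp: add_nonneg_eq_0_iff)
      then show ?thesis
        using mult_nonneg_nonneg[OF Lc] mono[OF n(1)] by (simp add: normx Pn)
    next
      case False
      then have sn: "s n \<in> {0<..<\<eta>}" using s(1)[of n] s\<eta>[OF n(1)] by simp
      have "1 \<le> \<psi>' (s n) * infdist 0 (clarke_subdifferential f (x n))"
        unfolding s_def using n(2) \<epsilon>(2) sn by (intro kl[rule_format]) (auto simp: s_def)
      also have "\<dots> \<le> \<psi>' (s n) * (L * norm (d n))"
        using n N(1) pos[OF sn] by (intro mult_left_mono error) auto
      \<comment> \<open>Multiplying by the step length produces the square of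
        \<open>norm (d n)\<close> with the weight that the guaranteed decrease carries.\<close>
      finally have "(1 + lam n) * norm (d n) * 1
          \<le> (1 + lam n) * norm (d n) * (\<psi>' (s n) * (L * norm (d n)))"
        using lam(1)[of n] by (intro mult_left_mono) auto
      also have "\<dots> = L / c * (\<psi>' (s n) * (c * (1 + lam n) * (norm (d n))\<^sup>2))"
        using \<open>0 < c\<close> by (simp add: power2_eq_square)
      also have "\<dots> \<le> L / c * (\<psi>' (s n) * (s n - s (Suc n)))"
        using pos[OF sn] desc by (intro mult_left_mono Lc) auto
      also have "\<dots> \<le> L / c * (\<psi> (s n) - \<psi> (s (Suc n)))"
        using sn by (intro mult_left_mono Lc tangent n(1)) simp
      finally show ?thesis by (simp add: normx Pn)
    qed
  qed
  with dlim show ?thesis by simp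
qed

section \<open>The boosted DC algorithm\<close>

text \<open>Nonnegativity is an invariant of the backtracking loop since \<open>\<beta>\<close> is
  positive; the decrease is the negated guard on exit.\<close>

lemma bdca_line_search_Some:
  assumes "bdca_line_search \<phi> \<alpha> \<beta> y d lbar = Some l" "0 \<le> lbar" "0 < \<beta>"
  shows "0 \<le> l" "\<phi> (y + l *\<^sub>R d) \<le> \<phi> y - ereal (\<alpha> * l\<^sup>2 * (norm d)\<^sup>2)"
proof -
  show "0 \<le> l"
    using while_option_rule[of "\<lambda>l. 0 \<le> l", OF _ assms(1)[unfolded bdca_line_search_def]] assms(2,3)
    by simp
  show "\<phi> (y + l *\<^sub>R d) \<le> \<phi> y - ereal (\<alpha> * l\<^sup>2 * (norm d)\<^sup>2)"
    using while_option_stop[OF assms(1)[unfolded bdca_line_search_def]] by simp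
qed


theorem theorem4p1:
  fixes g h :: "real ^ 'm \<Rightarrow> ereal"
    and \<rho> \<alpha> \<beta> :: real
    and x :: "nat \<Rightarrow> real ^ 'm"
    and xs :: "real ^ 'm"
  assumes "proper g" "proper h" "econvex g" "econvex h"
    and "\<rho> > 0" "strongly_econvex \<rho> g" "strongly_econvex \<rho> h"
    and "\<forall>z\<in>edom h. subdifferential h z \<noteq> {}"
    and "\<exists>O'. open O' \<and> edom h \<subseteq> O' \<and> cont_ediff_on g O'"
    and "(INF z. dc_objective g h z) > -\<infinity>"
    and "\<alpha> > 0" "0 < \<beta>" "\<beta> < 1"
    and "bdca_sequence g h \<alpha> \<beta> x"
    and "\<exists>r. strict_mono r \<and> (x \<circ> r) \<longlonglongrightarrow> xs"
    and "egradient_lipschitz_around g xs"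
    and "\<forall>z. \<bar>dc_objective g h z\<bar> \<noteq> \<infinity>"
    and "strong_KL (\<lambda>z. real_of_ereal (dc_objective g h z)) xs"
  shows "x \<longlonglongrightarrow> xs \<and> dc_critical g h xs"
proof -
  \<comment> \<open>With the conventions for infinite values, finiteness of \<open>g - h\<close> everywhere forces \<open>g\<close> and \<open>h\<close>
    to be finite everywhere.\<close>
  define G H where "G z = real_of_ereal (g z)" and "H z = real_of_ereal (h z)" for z
  have "\<bar>g z\<bar> \<noteq> \<infinity> \<and> \<bar>h z\<bar> \<noteq> \<infinity>" for z
    using assms(1,2) assms(17)[rule_format, of z] unfolding proper_def dc_objective_def
    by (cases "g z"; cases "h z") auto
  then have gG: "g z = ereal (G z)" and hH: "h z = ereal (H z)" for z
    by (simp_all add: G_def H_def ereal_real')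
  have phi: "dc_objective g h z = ereal (G z - H z)" for z
    by (simp add: dc_objective_def gG hH)
  have grad: "has_egradient g z v \<longleftrightarrow> GDERIV G z :> v" for z v
    by (simp add: has_egradient_def gG)
  have subd: "v \<in> subdifferential h z \<longleftrightarrow> is_subgradient H z v" for z v
    by (simp add: subdifferential_def edom_def hH is_subgradient_def algebra_simps)
  have edom: "edom h = UNIV" by (auto simp: edom_def hH)
  define G' where "G' = egradient g"
  have "cont_ediff_on g UNIV"
    using assms(9) edom by (metis top.extremum_uniqueI)
  then have ex: "\<exists>v. GDERIV G z :> v" and contG': "continuous_on UNIV G'" for z
    by (simp_all add: cont_ediff_on_def ediff_on_def grad G'_def)
  have G': "GDERIV G z :> G' z" for z
    unfolding G'_def egradient_def grad using ex GDERIV_unique by (metis theI')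
  have contG'_at: "isCont G' z" for z
    using contG' by (simp add: continuous_on_eq_continuous_at)
  have KL: "strong_KL (\<lambda>z. G z - H z) xs"
    using assms(18) by (simp add: phi)
  \<comment> \<open>Continuity of \<open>H\<close> comes from writing it as
    \<open>G - (G - H)\<close>: \<open>G\<close> is differentiable and \<open>G - H\<close> locally
    Lipschitz.\<close>
  have "isCont G z" for z
    using G'[of z] has_derivative_continuous unfolding gderiv_def by blast
  moreover have "isCont (\<lambda>z. G z - H z) z" for z
    using KL by (simp add: strong_KL_def locally_lipschitz_isCont)
  ultimately have "isCont (\<lambda>z. G z - (G z - H z)) z" for z
    by (rule continuous_diff)
  then have contH: "isCont H z" for z by simp
  then have contH_on: "continuous_on UNIV H" by (simp add: continuous_on_eq_continuous_at)
  have sub: "\<exists>v. is_subgradient H z v" for z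
    using assms(8) edom subd by blast
  have convex: "convex_on UNIV (\<lambda>z. F z - \<rho> / 2 * (norm z)\<^sup>2)"
    if "strongly_econvex \<rho> f" "\<And>z. f z = ereal (F z)" for f :: "real ^ 'm \<Rightarrow> ereal" and F
    using that(1) unfolding strongly_econvex_def econvex_def
    by (intro convex_onI) (simp_all add: that(2))
  have convG: "convex_on UNIV (\<lambda>z. G z - \<rho> / 2 * (norm z)\<^sup>2)"
    using assms(6) gG by (rule convex)
  have convH: "convex_on UNIV (\<lambda>z. H z - \<rho> / 2 * (norm z)\<^sup>2)"
    using assms(7) hH by (rule convex)

  obtain u y where run: "\<And>k. u k \<in> subdifferential h (x k) \<and>
      is_arg_min (\<lambda>z. g z - ereal (u k \<bullet> z)) (\<lambda>z. True) (y k) \<and>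
      (let d = y k - x k in
        if d = 0 then x (Suc k) = x k \<and> u (Suc k) = u k \<and> y (Suc k) = y k
        else \<exists>lbar\<ge>0. \<exists>l. bdca_line_search (dc_objective g h) \<alpha> \<beta> (y k) d lbar = Some l \<and>
          x (Suc k) = y k + l *\<^sub>R d)"
    using assms(14) unfolding bdca_sequence_def by (elim exE) (rule that, erule spec)
  define d where "d k = y k - x k" for k
  have u: "u k \<in> subdifferential h (x k)"
    and y: "is_arg_min (\<lambda>z. g z - ereal (u k \<bullet> z)) (\<lambda>z. True) (y k)" for k
    using run by blast+
  have stop: "x (Suc k) = x k" if "d k = 0" for k
    using run[of k] that by (simp add: d_def)
  have search: "\<exists>lbar\<ge>0. \<exists>l. bdca_line_search (dc_objective g h) \<alpha> \<beta> (y k) (d k) lbar = Some l \<and>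
      x (Suc k) = y k + l *\<^sub>R d k" if "d k \<noteq> 0" for k
    using run[of k] that by (simp add: d_def Let_def)
  have uH: "is_subgradient H (x k) (u k)" for k using u subd by blast
  have uG: "is_subgradient G (y k) (u k)" for k
    using y[of k] unfolding is_arg_min_def is_subgradient_def
    by (simp add: gG not_less inner_diff_right algebra_simps)
  have uy: "u k = G' (y k)" for k
    using G' uG by (rule GDERIV_subgradient_unique)
  \<comment> \<open>A stopped run fits the same recurrence with step 0, as then
    \<open>y k = x k\<close>; no case distinction is needed afterwards.\<close>
  have "\<exists>l\<ge>0. x (Suc k) = y k + l *\<^sub>R d k \<and>
      G (x (Suc k)) - H (x (Suc k)) \<le> G (y k) - H (y k) - \<alpha> * l\<^sup>2 * (norm (d k))\<^sup>2" for k
  proof (cases "d k = 0")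
    case True
    then show ?thesis using stop[OF True] by (intro exI[of _ 0]) (simp add: d_def)
  next
    case False
    then obtain lbar l where "0 \<le> lbar"
        "bdca_line_search (dc_objective g h) \<alpha> \<beta> (y k) (d k) lbar = Some l"
        "x (Suc k) = y k + l *\<^sub>R d k"
      using search by blast
    then show ?thesis
      using bdca_line_search_Some[of "dc_objective g h" \<alpha> \<beta> "y k" "d k" lbar l] \<open>0 < \<beta>\<close>
      by (intro exI[of _ l]) (simp add: phi)
  qed
  then obtain lam where lam: "\<And>k. 0 \<le> lam k" "\<And>k. x (Suc k) = y k + lam k *\<^sub>R d k"
    and ls: "\<And>k. G (x (Suc k)) - H (x (Suc k))
      \<le> G (y k) - H (y k) - \<alpha> * (lam k)\<^sup>2 * (norm (d k))\<^sup>2"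
    by metis
  \<comment> \<open>The inequalities for \<open>G\<close> from \<open>y k\<close> to
    \<open>x k\<close> and for \<open>H\<close> from \<open>x k\<close> to \<open>y k\<close> share
    \<open>u k\<close>: in their sum the linear terms cancel, and each contributes
    \<open>\<rho> / 2\<close>.\<close>
  have dc_step: "G (y k) - H (y k) \<le> G (x k) - H (x k) - \<rho> * (norm (d k))\<^sup>2" for k
    using strongly_convex_subgradient_ineq[OF convG uG, of k "x k"]
      strongly_convex_subgradient_ineq[OF convH uH, of k "y k"]
    by (simp add: d_def norm_minus_commute inner_diff_right)
  \<comment> \<open>Chosen so that \<open>c (1 + l)\<close> is at most the combined decrease
    \<open>\<rho> + \<alpha> l^2\<close>; the division by 2 pays for
    \<open>1 + l \<le> 2 (1 + l^2)\<close>.\<close>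
  define c where "c = min \<rho> \<alpha> / 2"
  have "0 < c" using \<open>0 < \<rho>\<close> \<open>0 < \<alpha>\<close> by (simp add: c_def)
  have c_le: "c * (1 + l) \<le> \<rho> + \<alpha> * l\<^sup>2" for l :: real
  proof -
    have "0 \<le> (l - 1)\<^sup>2 + 3 * l\<^sup>2 + 1" by simp
    then have "1 + l \<le> 2 * (1 + l\<^sup>2)" by (simp add: power2_eq_square algebra_simps)
    then have "c * (1 + l) \<le> c * (2 * (1 + l\<^sup>2))" using \<open>0 < c\<close> by (intro mult_left_mono) auto
    also have "\<dots> = min \<rho> \<alpha> + min \<rho> \<alpha> * l\<^sup>2" by (simp add: c_def algebra_simps)
    also have "\<dots> \<le> \<rho> + \<alpha> * l\<^sup>2" by (intro add_mono mult_right_mono) auto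
    finally show ?thesis .
  qed
  obtain r where r: "strict_mono r" "(x \<circ> r) \<longlonglongrightarrow> xs" using assms(15) by blast
  obtain U L where U: "open U" "xs \<in> U" and Lip: "L-lipschitz_on U G'"
    using assms(16) unfolding egradient_lipschitz_around_def G'_def by blast
  obtain \<epsilon> where \<epsilon>: "0 < \<epsilon>" "ball xs \<epsilon> \<subseteq> U" using U open_contains_ball by blast
  \<comment> \<open>Half the radius bounds \<open>x k - xs\<close> and \<open>d k\<close>
    separately, so that \<open>y k = x k + d k\<close> also stays in the ball where
    \<open>G'\<close> is Lipschitz.\<close>
  have "x \<longlonglongrightarrow> xs \<and> d \<longlonglongrightarrow> 0"
  proof (rule strong_KL_descent_convergence[OF KL r, of lam d c "\<epsilon> / 2" L])
    fix k
    show "0 \<le> lam k" by (rule lam)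
    show "x (Suc k) - x k = (1 + lam k) *\<^sub>R d k"
      by (simp add: lam(2) d_def algebra_simps)
    show "G (x (Suc k)) - H (x (Suc k)) + c * (1 + lam k) * (norm (d k))\<^sup>2 \<le> G (x k) - H (x k)"
      using ls[of k] dc_step[of k] mult_right_mono[OF c_le[of "lam k"], of "(norm (d k))\<^sup>2"]
      by (simp add: distrib_right)
    assume "x k \<in> ball xs (\<epsilon> / 2)" "norm (d k) < \<epsilon> / 2"
    then have "x k \<in> U" "y k \<in> U"
      using \<epsilon> dist_triangle[of xs "y k" "x k"]
      by (auto simp: d_def dist_norm norm_minus_commute)
    then have "norm (G' (x k) - G' (y k)) \<le> L * norm (d k)"
      using lipschitz_onD[OF Lip] by (metis d_def dist_commute dist_norm)
    then show "infdist 0 (clarke_subdifferential (\<lambda>z. G z - H z) (x k)) \<le> L * norm (d k)"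
      using infdist_clarke_subdifferential_le[OF G' contG'_at contH_on sub uH, of k] uy[of k] by simp
  qed (use \<open>0 < c\<close> \<epsilon>(1) lipschitz_on_nonneg[OF Lip] in auto)
  then have lim: "x \<longlonglongrightarrow> xs" "d \<longlonglongrightarrow> 0" by auto
  have "(\<lambda>k. x k + d k) \<longlonglongrightarrow> xs + 0" by (intro tendsto_intros lim)
  then have "y \<longlonglongrightarrow> xs" by (simp add: d_def)
  then have ulim: "u \<longlonglongrightarrow> G' xs"
    using isCont_tendsto_compose[OF contG'_at] by (simp add: uy[abs_def])
  \<comment> \<open>The graph of the subdifferential is closed: the inequalities at
    \<open>x k\<close> pass to the limit by continuity of \<open>H\<close>.\<close>
  have "is_subgradient H xs (G' xs)"
    unfolding is_subgradient_def
  proof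
    fix z
    have "(\<lambda>k. H (x k) + u k \<bullet> (z - x k)) \<longlonglongrightarrow> H xs + G' xs \<bullet> (z - xs)"
      by (intro tendsto_intros ulim lim isCont_tendsto_compose[OF contH])
    then show "H xs + G' xs \<bullet> (z - xs) \<le> H z"
      by (rule LIMSEQ_le_const2) (use uH in \<open>auto simp: is_subgradient_def\<close>)
  qed
  then have "dc_critical g h xs"
    unfolding dc_critical_def grad subd using G' by blast
  with lim(1) show ?thesis by blast
qed

end
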